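(* Let $M=\{1^{p_1},\dots,n^{p_n}\}$ be a multiset with $p_1,\dots,p_n$ positive integers, and let $d\ge0$ be an integer. Then $$\sum_{T\in\mathcal{T}_M}\#\{\text{nodes of } T \text{ with full-degree } 2d+1\}=2\sum_{T\in\mathcal{T}_M}\#\{\text{nodes of } T\text{ with degree } 2d+1\}.$$
   Context: A plane tree is a rooted tree in which the children of every node are linearly ordered. With $p=\sum p_i$, a weakly increasing tree on $M$ is a plane tree with $p+1$ nodes labeled by the elements of the multiset $M\cup\{0\}$ (with multiplicity) such that labels weakly increase along every root-to-leaf path and the labels of the children of each node weakly increase from left to right. $\mathcal{T}_M$ is the set of such trees. The degree of a node is its number of children. The full-degree of a node $v$ is the number of nodes adjacent to $v$ (its degree plus one, unless $v$ is the root, in which case it equals its degree). *)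

theory Defs
  imports "HOL-Library.Multiset"
begin

datatype 'a plane_tree = Node (root_label: 'a) (children: "'a plane_tree list")

text \<open>
  A node is addressed by the list of child positions leading to it from the root, so the root
  is \<^term>\<open>[] :: nat list\<close> and the children of the node \<open>v\<close> are the addresses \<open>v @ [i]\<close>.
\<close>

fun subtree_at :: "'a plane_tree \<Rightarrow> nat list \<Rightarrow> 'a plane_tree option" where
  "subtree_at t [] = Some t"
| "subtree_at t (i # v) =
     (if i < length (children t) then subtree_at (children t ! i) v else None)"

definition nodes :: "'a plane_tree \<Rightarrow> nat list set" where
  "nodes t = {v. subtree_at t v \<noteq> None}"

definition child_of :: "nat list \<Rightarrow> nat list \<Rightarrow> bool" where
  "child_of u v \<longleftrightarrow> (\<exists>i. u = v @ [i])"

definition node_degree :: "'a plane_tree \<Rightarrow> nat list \<Rightarrow> nat" where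
  "node_degree t v = card {u \<in> nodes t. child_of u v}"

definition full_degree :: "'a plane_tree \<Rightarrow> nat list \<Rightarrow> nat" where
  "full_degree t v = card {u \<in> nodes t. child_of u v \<or> child_of v u}"

fun labels :: "'a plane_tree \<Rightarrow> 'a multiset" where
  "labels (Node a ts) = add_mset a (\<Sum>t\<leftarrow>ts. labels t)"

text \<open>The label sequences read along the root-to-leaf paths.\<close>

fun path_labels :: "'a plane_tree \<Rightarrow> 'a list list" where
  "path_labels (Node a ts) =
     (if ts = [] then [[a]] else map ((#) a) (concat (map path_labels ts)))"

definition weakly_increasing :: "nat plane_tree \<Rightarrow> bool" where
  "weakly_increasing t \<longleftrightarrow>
     (\<forall>xs \<in> set (path_labels t). sorted xs) \<and>
     (\<forall>v \<in> nodes t. sorted (map root_label (children (the (subtree_at t v)))))"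

definition weakly_increasing_trees :: "nat multiset \<Rightarrow> nat plane_tree set" where
  "weakly_increasing_trees M = {t. labels t = add_mset 0 M \<and> weakly_increasing t}"

definition multiset_of_mults :: "nat \<Rightarrow> (nat \<Rightarrow> nat) \<Rightarrow> nat multiset" where
  "multiset_of_mults n p = (\<Sum>i = 1..n. replicate_mset (p i) i)"

text \<open>
  The cardinalities and sums above range over finite sets, and the degrees have the expected
  values.
\<close>

lemma subtree_at_append:
  "subtree_at t (u @ v) = Option.bind (subtree_at t u) (\<lambda>s. subtree_at s v)"
  by (induction t u rule: subtree_at.induct) auto

lemma nodes_snoc:
  "v @ [i] \<in> nodes t \<longleftrightarrow> v \<in> nodes t \<and> i < length (children (the (subtree_at t v)))"
  by (cases "subtree_at t v") (auto simp: nodes_def subtree_at_append)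

lemma nodes_Node:
  "nodes (Node a ts) = insert [] (\<Union>i<length ts. (#) i ` nodes (ts ! i))"
proof (intro set_eqI)
  fix v
  show "v \<in> nodes (Node a ts) \<longleftrightarrow> v \<in> insert [] (\<Union>i<length ts. (#) i ` nodes (ts ! i))"
    by (cases v) (auto simp: nodes_def split: if_splits)
qed

lemma finite_nodes: "finite (nodes t)"
  by (induction t) (auto simp: nodes_Node)

lemma child_nodes:
  assumes "v \<in> nodes t"
  shows "{u \<in> nodes t. child_of u v} =
    (\<lambda>i. v @ [i]) ` {..<length (children (the (subtree_at t v)))}"
  using assms by (auto simp: child_of_def nodes_snoc)

lemma node_degree_eq:
  assumes "v \<in> nodes t"
  shows "node_degree t v = length (children (the (subtree_at t v)))"
  unfolding node_degree_def child_nodes[OF assms]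
  by (subst card_image) (auto simp: inj_on_def)

lemma full_degree_eq:
  assumes "v \<in> nodes t"
  shows "full_degree t v = (if v = [] then node_degree t v else node_degree t v + 1)"
proof (cases v rule: rev_cases)
  case Nil
  then show ?thesis by (simp add: full_degree_def node_degree_def child_of_def)
next
  case (snoc w i)
  have "w \<in> nodes t" using assms snoc by (simp add: nodes_snoc)
  then have "{u \<in> nodes t. child_of u v \<or> child_of v u} = insert w {u \<in> nodes t. child_of u v}"
    using snoc by (auto simp: child_of_def)
  moreover have "w \<notin> {u \<in> nodes t. child_of u v}"
    using snoc by (auto simp: child_of_def)
  ultimately show ?thesis
    using snoc finite_nodes[of t] by (simp add: full_degree_def node_degree_def)
qed

lemma labels_subtree: "t \<in> set ts \<Longrightarrow> labels t \<subseteq># (\<Sum>t\<leftarrow>ts. labels t)"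
  by (induction ts) (auto intro: subset_mset.order_trans mset_subset_eq_add_right)

lemma length_le_labels: "length ts \<le> size (\<Sum>t\<leftarrow>ts. labels t)"
proof (induction ts)
  case (Cons t ts)
  have "size (labels t) \<ge> 1" by (cases t) simp
  with Cons show ?case by simp
qed simp

lemma finite_trees_bounded:
  assumes "finite A"
  shows "finite {t. size (labels t) \<le> k \<and> set_mset (labels t) \<subseteq> A}"
proof (induction k)
  case 0
  have "{t. size (labels t) \<le> 0 \<and> set_mset (labels t) \<subseteq> A} = {}"
    by (auto elim: labels.elims)
  then show ?case by simp
next
  case (Suc k)
  let ?S = "{t. size (labels t) \<le> k \<and> set_mset (labels t) \<subseteq> A}"
  have "{t. size (labels t) \<le> Suc k \<and> set_mset (labels t) \<subseteq> A}
    \<subseteq> (\<lambda>(a, ts). Node a ts) ` (A \<times> {ts. set ts \<subseteq> ?S \<and> length ts \<le> k})"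
  proof
    fix t assume "t \<in> {t. size (labels t) \<le> Suc k \<and> set_mset (labels t) \<subseteq> A}"
    moreover obtain a ts where t: "t = Node a ts" by (cases t)
    ultimately have sz: "size (\<Sum>t\<leftarrow>ts. labels t) \<le> k" and a: "a \<in> A"
      and sub: "set_mset (\<Sum>t\<leftarrow>ts. labels t) \<subseteq> A" by auto
    have "s \<in> ?S" if "s \<in> set ts" for s
      using labels_subtree[OF that] sz sub size_mset_mono set_mset_mono
      by (metis (mono_tags, lifting) mem_Collect_eq order_trans)
    with a t sz length_le_labels[of ts]
    show "t \<in> (\<lambda>(a, ts). Node a ts) ` (A \<times> {ts. set ts \<subseteq> ?S \<and> length ts \<le> k})"
      by (intro image_eqI[where x = "(a, ts)"]) auto
  qed
  moreover have "finite \<dots>"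
    using assms Suc by (intro finite_imageI finite_cartesian_product finite_lists_length_le)
  ultimately show ?case by (rule finite_subset)
qed

lemma finite_weakly_increasing_trees: "finite (weakly_increasing_trees M)"
  by (rule finite_subset[OF _ finite_trees_bounded[of "insert 0 (set_mset M)" "Suc (size M)"]])
     (auto simp: weakly_increasing_trees_def)

end

theory Submission
  imports Defs
begin

text \<open>
  Let \<open>v\<close> be a non-root node. Its children and its right siblings are two sequences of subtrees
  whose root labels weakly increase and are at least the label of \<open>v\<close>, so exchanging the two
  sequences is an involution on weakly increasing trees with a marked non-root node. Hence
  non-root nodes of degree \<open>k\<close> are equinumerous with non-root nodes having \<open>k\<close> right siblings,
  that is, with nodes of degree greater than \<open>k\<close>. Write \<open>a\<^sub>k\<close>, \<open>r\<^sub>k\<close>, \<open>N\<^sub>k\<close> for the total number of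
  nodes, roots and non-root nodes of degree \<open>k\<close>. Subtracting this identity for \<open>k + 1\<close> from the
  one for \<open>k\<close> gives \<open>N\<^sub>k = N\<^sub>k\<^sub>+\<^sub>1 + a\<^sub>k\<^sub>+\<^sub>1\<close>, so the number of nodes of full-degree \<open>k + 1\<close> is
  \<open>r\<^sub>k\<^sub>+\<^sub>1 + N\<^sub>k = 2 a\<^sub>k\<^sub>+\<^sub>1\<close>.
\<close>

text \<open>Every path of a child starts with the label of that child, and each child has at least
  one path, so sortedness of the extended paths costs exactly one comparison per child. This local
  form is what inductions on the tree can use.\<close>

lemma weakly_increasing_Node:
  "weakly_increasing (Node a ts) \<longleftrightarrow>
     sorted (map root_label ts) \<and> (\<forall>t \<in> set ts. a \<le> root_label t \<and> weakly_increasing t)"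
proof -
  have hd_path: "\<exists>ys. xs = root_label t # ys" if "xs \<in> set (path_labels t)"
    for xs and t :: "nat plane_tree"
    using that by (cases t) (auto split: if_splits)
  have path_ne: "path_labels t \<noteq> []" for t :: "nat plane_tree"
    by (induction t) auto
  have paths: "(\<forall>xs \<in> set (path_labels (Node a ts)). sorted xs) \<longleftrightarrow>
      (\<forall>t \<in> set ts. a \<le> root_label t \<and> (\<forall>xs \<in> set (path_labels t). sorted xs))"
  proof -
    have "(\<forall>xs \<in> set (path_labels t). sorted (a # xs)) \<longleftrightarrow>
        a \<le> root_label t \<and> (\<forall>xs \<in> set (path_labels t). sorted xs)" for t
    proof -
      have "sorted (a # xs) \<longleftrightarrow> a \<le> root_label t \<and> sorted xs" if "xs \<in> set (path_labels t)" for xs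
        using hd_path[OF that] by force
      then show ?thesis
        using path_ne[of t] by (metis last_in_set)
    qed
    then show ?thesis by (auto simp del: sorted_simps)
  qed
  have sibs: "(\<forall>v \<in> nodes (Node a ts).
        sorted (map root_label (children (the (subtree_at (Node a ts) v))))) \<longleftrightarrow>
      sorted (map root_label ts) \<and>
      (\<forall>t \<in> set ts. \<forall>v \<in> nodes t. sorted (map root_label (children (the (subtree_at t v)))))"
    by (auto simp: nodes_Node all_set_conv_all_nth)
  show ?thesis
    unfolding weakly_increasing_def paths sibs by auto
qed

text \<open>
  \<open>exchange t u i\<close> exchanges the children of the node \<open>u @ [i]\<close> with its right siblings; the
  address of that node does not change.
\<close>

fun exchange :: "'a plane_tree \<Rightarrow> nat list \<Rightarrow> nat \<Rightarrow> 'a plane_tree" where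
  "exchange (Node a ts) [] i =
     Node a (take i ts @ Node (root_label (ts ! i)) (drop (Suc i) ts) # children (ts ! i))"
| "exchange (Node a ts) (j # u) i = Node a (ts[j := exchange (ts ! j) u i])"

lemma root_label_exchange: "root_label (exchange t u i) = root_label t"
  by (cases "(t, u, i)" rule: exchange.cases) auto

lemma in_nodes_Cons:
  "j # u \<in> nodes (Node a ts) \<longleftrightarrow> j < length ts \<and> u \<in> nodes (ts ! j)"
  by (simp add: nodes_def)

lemma subtree_at_exchange:
  "u \<in> nodes t \<Longrightarrow> subtree_at (exchange t u i) u = Some (exchange (the (subtree_at t u)) [] i)"
  by (induction t u i rule: exchange.induct) (auto simp: in_nodes_Cons)

text \<open>The \<open>i\<close> left siblings are untouched, so the marked node is again at
  position \<open>i\<close> and the second exchange swaps the same two lists back.\<close>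

lemma exchange_exchange:
  "u @ [i] \<in> nodes t \<Longrightarrow> exchange (exchange t u i) u i = t"
proof (induction t u i rule: exchange.induct)
  case (1 a ts i)
  then show ?case
    by (auto simp: in_nodes_Cons nth_append min_def id_take_nth_drop[symmetric])
next
  case (2 a ts j u i)
  then show ?case by (auto simp: in_nodes_Cons)
qed

lemma labels_exchange:
  "u @ [i] \<in> nodes t \<Longrightarrow> labels (exchange t u i) = labels t"
proof (induction t u i rule: exchange.induct)
  case (1 a ts i)
  then have i: "i < length ts" by (simp add: in_nodes_Cons)
  obtain b cs where b: "ts ! i = Node b cs" by (cases "ts ! i")
  have "(\<Sum>t\<leftarrow>ts. labels t) = (\<Sum>t\<leftarrow>take i ts @ Node b cs # drop (Suc i) ts. labels t)"
    using id_take_nth_drop[OF i] b by simp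
  then show ?case by (simp add: b)
next
  case (2 a ts j u i)
  then have j: "j < length ts" and IH: "labels (exchange (ts ! j) u i) = labels (ts ! j)"
    by (auto simp: in_nodes_Cons)
  have "map labels (ts[j := exchange (ts ! j) u i]) = map labels ts"
    using j IH by (simp add: map_update list_update_same_conv)
  then show ?case by simp
qed

lemma weakly_increasing_exchange:
  "u @ [i] \<in> nodes t \<Longrightarrow> weakly_increasing t \<Longrightarrow> weakly_increasing (exchange t u i)"
proof (induction t u i rule: exchange.induct)
  case (1 a ts i)
  then have i: "i < length ts" by (simp add: in_nodes_Cons)
  obtain b cs where b: "ts ! i = Node b cs" by (cases "ts ! i")
  define xs ys where "xs = take i ts" and "ys = drop (Suc i) ts"
  have ts: "ts = xs @ Node b cs # ys"
    using id_take_nth_drop[OF i] b by (simp add: xs_def ys_def)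
  \<comment> \<open>The labels of \<open>cs\<close> and \<open>ys\<close> are at least
    \<open>b\<close>, and \<open>b\<close> is at least \<open>a\<close> and every label of
    \<open>xs\<close>, so both lists fit in either place.\<close>
  have "weakly_increasing (Node a (xs @ Node b ys # cs))"
    using "1.prems"(2) unfolding ts
    by (fastforce simp: weakly_increasing_Node sorted_append intro: order_trans)
  then show ?case by (simp add: b xs_def ys_def)
next
  case (2 a ts j u i)
  then have j: "j < length ts" by (simp add: in_nodes_Cons)
  \<comment> \<open>An exchange deeper down keeps the root label of child \<open>j\<close>, so the
    comparisons at this level are unaffected.\<close>
  have "map root_label (ts[j := exchange (ts ! j) u i]) = map root_label ts"
    using j by (simp add: map_update list_update_same_conv root_label_exchange)
  with 2 j show ?case
    by (auto simp: weakly_increasing_Node in_nodes_Cons root_label_exchange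
        dest!: set_update_subset_insert[THEN subsetD])
qed

lemma exchange_in_trees:
  "t \<in> weakly_increasing_trees M \<Longrightarrow> u @ [i] \<in> nodes t \<Longrightarrow>
     exchange t u i \<in> weakly_increasing_trees M"
  by (simp add: weakly_increasing_trees_def labels_exchange weakly_increasing_exchange)

text \<open>Afterwards \<open>u\<close> has as children the \<open>i\<close> left siblings, the
  marked node itself and the former children of that node; the marked node receives the former right
  siblings.\<close>

lemma exchange_degrees:
  assumes "u @ [i] \<in> nodes t"
  shows "u @ [i] \<in> nodes (exchange t u i)"
    and "node_degree (exchange t u i) u = i + 1 + node_degree t (u @ [i])"
    and "node_degree (exchange t u i) (u @ [i]) = node_degree t u - Suc i"
proof -
  have u: "u \<in> nodes t" and i: "i < length (children (the (subtree_at t u)))"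
    using assms by (auto simp: nodes_snoc)
  obtain a ts where t: "subtree_at t u = Some (Node a ts)"
    using u by (metis (mono_tags) nodes_def mem_Collect_eq not_None_eq plane_tree.exhaust)
  with i have i': "i < length ts" by simp
  note sub = subtree_at_exchange[OF u, of i, unfolded t, simplified]
  have u': "u \<in> nodes (exchange t u i)" using sub by (simp add: nodes_def)
  show mem: "u @ [i] \<in> nodes (exchange t u i)"
    using u' sub i' by (simp add: nodes_snoc)
  show "node_degree (exchange t u i) u = i + 1 + node_degree t (u @ [i])"
    using i' by (simp add: node_degree_eq[OF u'] node_degree_eq[OF assms] sub subtree_at_append t)
  show "node_degree (exchange t u i) (u @ [i]) = node_degree t u - Suc i"
    using i' by (simp add: node_degree_eq[OF mem] node_degree_eq[OF u] sub subtree_at_append t nth_append)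
qed

lemma card_nonroot_degree:
  "card (SIGMA T:weakly_increasing_trees M. {v \<in> nodes T. v \<noteq> [] \<and> node_degree T v = k})
   = card (SIGMA T:weakly_increasing_trees M. {v \<in> nodes T. k < node_degree T v})"
  (is "card ?X = card ?Z")
proof -
  define f :: "nat plane_tree \<times> nat list \<Rightarrow> nat plane_tree \<times> nat list"
    where "f = (\<lambda>(T, v). (exchange T (butlast v) (last v), butlast v))"
  \<comment> \<open>\<open>f\<close> forgets the position of the marked node. It is recovered as the
    one child of \<open>u\<close> with exactly \<open>k\<close> right siblings, which exists because
    the degree of \<open>u\<close> exceeds \<open>k\<close>.\<close>
  define g :: "nat plane_tree \<times> nat list \<Rightarrow> nat plane_tree \<times> nat list"
    where "g = (\<lambda>(T, u). let i = node_degree T u - Suc k in (exchange T u i, u @ [i]))"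
  have X: "f x \<in> ?Z \<and> g (f x) = x" if "x \<in> ?X" for x
  proof -
    obtain T v where "x = (T, v)" by fastforce
    moreover from this that have "v \<noteq> []" by simp
    then obtain u i where "v = u @ [i]" by (metis rev_exhaust)
    ultimately have x: "x = (T, u @ [i])" and T: "T \<in> weakly_increasing_trees M"
      and ui: "u @ [i] \<in> nodes T" and k: "node_degree T (u @ [i]) = k"
      using that by auto
    show ?thesis
      using exchange_degrees[OF ui] exchange_in_trees[OF T ui] exchange_exchange[OF ui] k
      by (auto simp: x f_def g_def nodes_snoc)
  qed
  have Z: "g z \<in> ?X \<and> f (g z) = z" if z_in: "z \<in> ?Z" for z
  proof -
    obtain T u where z: "z = (T, u)" and T: "T \<in> weakly_increasing_trees M"
      and u: "u \<in> nodes T" and k: "k < node_degree T u"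
      using z_in by auto
    define i where "i = node_degree T u - Suc k"
    have ui: "u @ [i] \<in> nodes T"
      using u k node_degree_eq[OF u] by (simp add: nodes_snoc i_def)
    have "node_degree T u - Suc i = k" using k by (simp add: i_def)
    then show ?thesis
      using exchange_degrees[OF ui] exchange_in_trees[OF T ui] exchange_exchange[OF ui]
      by (auto simp: z f_def g_def Let_def i_def[symmetric])
  qed
  have "bij_betw f ?X ?Z"
    by (rule bij_betw_byWitness[where f' = g]) (use X Z in blast)+
  then show ?thesis by (rule bij_betw_same_card)
qed

text \<open>Writing \<open>k + 1\<close> lets the degree \<open>k\<close> of the non-root nodes
  concerned appear without subtraction.\<close>

lemma sum_full_degree:
  "(\<Sum>T \<in> weakly_increasing_trees M. card {v \<in> nodes T. full_degree T v = k + 1})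
   = 2 * (\<Sum>T \<in> weakly_increasing_trees M. card {v \<in> nodes T. node_degree T v = k + 1})"
proof -
  define W where "W = weakly_increasing_trees M"
  define total where "total P = (\<Sum>T \<in> W. card {v \<in> nodes T. P T v})"
    for P :: "nat plane_tree \<Rightarrow> nat list \<Rightarrow> bool"
  have total_card: "total P = card (SIGMA T:W. {v \<in> nodes T. P T v})" for P
    unfolding total_def W_def
    by (subst card_SigmaI) (auto simp: finite_weakly_increasing_trees finite_nodes)
  \<comment> \<open>The equivalence is asked for at nodes only, since \<open>full_degree_eq\<close>
    is available only there.\<close>
  have total_split: "total P = total Q + total R"
    if "\<And>T v. v \<in> nodes T \<Longrightarrow> P T v \<longleftrightarrow> Q T v \<or> R T v" "\<And>T v. \<not> (Q T v \<and> R T v)" for P Q R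
    unfolding total_def sum.distrib[symmetric]
  proof (intro sum.cong refl)
    fix T
    have "{v \<in> nodes T. P T v} = {v \<in> nodes T. Q T v} \<union> {v \<in> nodes T. R T v}"
      using that(1) by auto
    then show "card {v \<in> nodes T. P T v} = card {v \<in> nodes T. Q T v} + card {v \<in> nodes T. R T v}"
      using that(2) by (auto simp: finite_nodes intro!: card_Un_disjoint)
  qed
  have nonroot: "total (\<lambda>T v. v \<noteq> [] \<and> node_degree T v = j) = total (\<lambda>T v. j < node_degree T v)" for j
    unfolding total_card W_def by (rule card_nonroot_degree)
  have "total (\<lambda>T v. full_degree T v = k + 1)
      = total (\<lambda>T v. v = [] \<and> node_degree T v = k + 1) + total (\<lambda>T v. v \<noteq> [] \<and> node_degree T v = k)"
    by (rule total_split) (auto simp: full_degree_eq)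
  \<comment> \<open>The bijection turns degree \<open>k\<close> into degree above \<open>k\<close>.
    Splitting off degree exactly \<open>k + 1\<close> leaves a count to which the bijection applies
    backwards, now at \<open>k + 1\<close>.\<close>
  also have "total (\<lambda>T v. v \<noteq> [] \<and> node_degree T v = k)
      = total (\<lambda>T v. node_degree T v = k + 1) + total (\<lambda>T v. k + 1 < node_degree T v)"
    unfolding nonroot by (rule total_split) auto
  also have "total (\<lambda>T v. k + 1 < node_degree T v) = total (\<lambda>T v. v \<noteq> [] \<and> node_degree T v = k + 1)"
    by (rule nonroot[symmetric])
  finally have "total (\<lambda>T v. full_degree T v = k + 1)
      = total (\<lambda>T v. node_degree T v = k + 1)
        + (total (\<lambda>T v. v = [] \<and> node_degree T v = k + 1)
           + total (\<lambda>T v. v \<noteq> [] \<and> node_degree T v = k + 1))"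
    by simp
  also have "total (\<lambda>T v. v = [] \<and> node_degree T v = k + 1)
      + total (\<lambda>T v. v \<noteq> [] \<and> node_degree T v = k + 1) = total (\<lambda>T v. node_degree T v = k + 1)"
    by (rule total_split[symmetric]) auto
  finally show ?thesis by (simp add: total_def W_def)
qed

theorem theorem2p9:
  fixes n d :: nat and p :: "nat \<Rightarrow> nat"
  assumes "\<And>i. i \<in> {1..n} \<Longrightarrow> p i > 0"
  shows "(\<Sum>T \<in> weakly_increasing_trees (multiset_of_mults n p).
            card {v \<in> nodes T. full_degree T v = 2 * d + 1})
       = 2 * (\<Sum>T \<in> weakly_increasing_trees (multiset_of_mults n p).
            card {v \<in> nodes T. node_degree T v = 2 * d + 1})"
  by (rule sum_full_degree)

end
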